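(* Let $R$ be a ring such that $R$ has the ascending chain condition on ideals, every pair of incomparable prime ideals of $R$ is comaximal, and for any ideals $A,B$ of $R$ there is a positive integer $k$ with $A^k\cap B^k\subseteq AB$. Let $M$ be a nonzero right $R$-module. (1) If $\underline{r}_R(M)\neq 0$, then there exist a set $\{P_i\}_{i=1}^n$ of prime ideals of $R$ and positive integers $k_i$, $1\leq i\leq n$, such that $\bigcap_{i=1}^nP_i^{k_i}\subseteq\underline{r}_R(M)$, each $\underline{\ell}_M(P_i^{k_i})\neq 0$, and $M=\bigoplus_{i=1}^n\underline{\ell}_M(P_i^{k_i})$. (2) Suppose that $\{Q_i\}_{i\in I}$ is the set of minimal prime ideals of $R$, with $|I|\geq 2$, and that $Y$ is a set of generators of $M$. If $\underline{r}_R(yR)\neq 0$ for each $y\in Y$, then $M=\bigoplus_{i\in I}C(Q_i)$.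
   Context: Rings are associative with identity, not necessarily commutative; modules are unital right modules; ideals are two-sided. Ideals $X,Y$ of $R$ are comaximal if $X+Y=R$; they are incomparable if neither contains the other. For $X\subseteq R$, $\underline{\ell}_M(X)=\{m\in M\mid mx=0\text{ for all }x\in X\}$; for $N\subseteq M$, $\underline{r}_R(N)=\{r\in R\mid nr=0\text{ for all }n\in N\}$. For an ideal $X$ of $R$, the component of $X$ in $M$ is $C(X)=\sum_{k\ge 1}\underline{\ell}_M(X^k)$. Direct sums of submodules are internal. *)

theory Defs
  imports "HOL-Algebra.Ideal_Product"
begin

section \<open>Ideals of a not necessarily commutative ring\<close>

text \<open>The nat-power in \<open>ideals_set R\<close> iterates \<open>ideal_prod\<close>, starting from \<open>carrier R\<close>.\<close>

abbreviation ideal_pow :: "('a, 'b) ring_scheme \<Rightarrow> 'a set \<Rightarrow> nat \<Rightarrow> 'a set" where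
  "ideal_pow R X k \<equiv> X [^]\<^bsub>ideals_set R\<^esub> k"

definition acc_on_ideals :: "('a, 'b) ring_scheme \<Rightarrow> bool" where
  "acc_on_ideals R \<longleftrightarrow>
     (\<forall>A :: nat \<Rightarrow> 'a set. (\<forall>n. ideal (A n) R) \<and> (\<forall>n. A n \<subseteq> A (Suc n))
        \<longrightarrow> (\<exists>N. \<forall>n\<ge>N. A n = A N))"

definition comaximal :: "('a, 'b) ring_scheme \<Rightarrow> 'a set \<Rightarrow> 'a set \<Rightarrow> bool" where
  "comaximal R X Y \<longleftrightarrow> X <+>\<^bsub>R\<^esub> Y = carrier R"

definition incomparable :: "'a set \<Rightarrow> 'a set \<Rightarrow> bool" where
  "incomparable X Y \<longleftrightarrow> \<not> X \<subseteq> Y \<and> \<not> Y \<subseteq> X"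

text \<open>The library's \<open>primeideal\<close> assumes commutativity and is defined on elements;
  over a noncommutative ring primeness refers to products of ideals.\<close>

definition prime_ideal :: "('a, 'b) ring_scheme \<Rightarrow> 'a set \<Rightarrow> bool" where
  "prime_ideal R P \<longleftrightarrow> ideal P R \<and> P \<noteq> carrier R \<and>
     (\<forall>A B. ideal A R \<and> ideal B R \<and> A \<cdot>\<^bsub>R\<^esub> B \<subseteq> P \<longrightarrow> A \<subseteq> P \<or> B \<subseteq> P)"

definition minimal_prime_ideal :: "('a, 'b) ring_scheme \<Rightarrow> 'a set \<Rightarrow> bool" where
  "minimal_prime_ideal R P \<longleftrightarrow> prime_ideal R P \<and> (\<forall>P'. prime_ideal R P' \<and> P' \<subseteq> P \<longrightarrow> P' = P)"


section \<open>Right modules\<close>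

text \<open>As for the library's \<open>module\<close>, the fields \<open>mult\<close> and \<open>one\<close>
  inherited from \<open>ring\<close> carry no meaning.\<close>

record ('a, 'm) right_module = "'m ring" +
  ract :: "['m, 'a] \<Rightarrow> 'm" (infixl \<open>\<triangleleft>\<index>\<close> 70)

locale right_module = R?: ring R + M?: abelian_group M for R (structure) and M (structure) +
  assumes ract_closed [simp, intro]:
      "\<lbrakk>x \<in> carrier M; a \<in> carrier R\<rbrakk> \<Longrightarrow> x \<triangleleft>\<^bsub>M\<^esub> a \<in> carrier M"
    and ract_l_distr:
      "\<lbrakk>x \<in> carrier M; y \<in> carrier M; a \<in> carrier R\<rbrakk> \<Longrightarrow>
       (x \<oplus>\<^bsub>M\<^esub> y) \<triangleleft>\<^bsub>M\<^esub> a = x \<triangleleft>\<^bsub>M\<^esub> a \<oplus>\<^bsub>M\<^esub> y \<triangleleft>\<^bsub>M\<^esub> a"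
    and ract_r_distr:
      "\<lbrakk>x \<in> carrier M; a \<in> carrier R; b \<in> carrier R\<rbrakk> \<Longrightarrow>
       x \<triangleleft>\<^bsub>M\<^esub> (a \<oplus>\<^bsub>R\<^esub> b) = x \<triangleleft>\<^bsub>M\<^esub> a \<oplus>\<^bsub>M\<^esub> x \<triangleleft>\<^bsub>M\<^esub> b"
    and ract_assoc:
      "\<lbrakk>x \<in> carrier M; a \<in> carrier R; b \<in> carrier R\<rbrakk> \<Longrightarrow>
       x \<triangleleft>\<^bsub>M\<^esub> (a \<otimes>\<^bsub>R\<^esub> b) = (x \<triangleleft>\<^bsub>M\<^esub> a) \<triangleleft>\<^bsub>M\<^esub> b"
    and ract_one [simp]:
      "x \<in> carrier M \<Longrightarrow> x \<triangleleft>\<^bsub>M\<^esub> \<one>\<^bsub>R\<^esub> = x"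

definition right_submodule ::
    "('a, 'b) ring_scheme \<Rightarrow> ('a, 'm, 'c) right_module_scheme \<Rightarrow> 'm set \<Rightarrow> bool" where
  "right_submodule R M N \<longleftrightarrow>
     subgroup N (add_monoid M) \<and> (\<forall>x\<in>N. \<forall>a\<in>carrier R. x \<triangleleft>\<^bsub>M\<^esub> a \<in> N)"

definition generates ::
    "('a, 'b) ring_scheme \<Rightarrow> ('a, 'm, 'c) right_module_scheme \<Rightarrow> 'm set \<Rightarrow> bool" where
  "generates R M Y \<longleftrightarrow>
     Y \<subseteq> carrier M \<and> \<Inter>{N. right_submodule R M N \<and> Y \<subseteq> N} = carrier M"

definition cyclic_submodule ::
    "('a, 'b) ring_scheme \<Rightarrow> ('a, 'm, 'c) right_module_scheme \<Rightarrow> 'm \<Rightarrow> 'm set" where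
  "cyclic_submodule R M y = {y \<triangleleft>\<^bsub>M\<^esub> a | a. a \<in> carrier R}"

definition l_ann :: "('a, 'm, 'c) right_module_scheme \<Rightarrow> 'a set \<Rightarrow> 'm set" where
  "l_ann M X = {m \<in> carrier M. \<forall>x\<in>X. m \<triangleleft>\<^bsub>M\<^esub> x = \<zero>\<^bsub>M\<^esub>}"

definition r_ann ::
    "('a, 'b) ring_scheme \<Rightarrow> ('a, 'm, 'c) right_module_scheme \<Rightarrow> 'm set \<Rightarrow> 'a set" where
  "r_ann R M N = {r \<in> carrier R. \<forall>n\<in>N. n \<triangleleft>\<^bsub>M\<^esub> r = \<zero>\<^bsub>M\<^esub>}"

text \<open>The sum of a possibly infinite family of submodules consists of the finite sums of elements
  of its members; the sum of the empty family is the zero submodule.\<close>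

definition sum_family ::
    "('a, 'm, 'c) right_module_scheme \<Rightarrow> 'i set \<Rightarrow> ('i \<Rightarrow> 'm set) \<Rightarrow> 'm set" where
  "sum_family M I N =
     {finsum M x J | x J. finite J \<and> J \<subseteq> I \<and> (\<forall>j\<in>J. x j \<in> N j)}"

definition is_direct_sum ::
    "('a, 'b) ring_scheme \<Rightarrow> ('a, 'm, 'c) right_module_scheme \<Rightarrow> 'i set \<Rightarrow> ('i \<Rightarrow> 'm set) \<Rightarrow> bool"
  where
  "is_direct_sum R M I N \<longleftrightarrow>
     (\<forall>i\<in>I. right_submodule R M (N i)) \<and>
     sum_family M I N = carrier M \<and>
     (\<forall>i\<in>I. N i \<inter> sum_family M (I - {i}) N = {\<zero>\<^bsub>M\<^esub>})"

definition component ::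
    "('a, 'b) ring_scheme \<Rightarrow> ('a, 'm, 'c) right_module_scheme \<Rightarrow> 'a set \<Rightarrow> 'm set" where
  "component R M X = sum_family M {1..} (\<lambda>k. l_ann M (ideal_pow R X k))"

end

theory Submission
  imports Defs
begin

text \<open>
  The condition \<open>A\<^sup>k \<inter> B\<^sup>k \<subseteq> A B\<close> makes the powers of a finite intersection cofinal with the
  intersections of the powers. By Noetherian induction every ideal therefore contains an
  intersection of powers of finitely many primes; for the zero ideal these may be taken to be the
  minimal primes \<open>Q\<^sub>i\<close>, so there are finitely many of them and \<open>\<Inter>i. Q\<^sub>i\<^sup>N = 0\<close> for some \<open>N\<close>.
  Distinct minimal primes are incomparable, so their powers are comaximal, and as in the
  Chinese remainder theorem every module is the direct sum of the annihilators of the \<open>Q\<^sub>i\<^sup>N\<close>.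
  For (1) the minimal primes with zero annihilator are dropped; for (2) the summands are seen to
  stay independent when enlarged to the components.
\<close>

section \<open>Ideals, powers and comaximality\<close>

text \<open>Intersecting with \<open>carrier R\<close> makes the empty meet the unit ideal instead
  of \<open>UNIV\<close>, so a meet of ideals is an ideal for every index set.\<close>

definition ideal_meet :: "('a, 'b) ring_scheme \<Rightarrow> 'i set \<Rightarrow> ('i \<Rightarrow> 'a set) \<Rightarrow> 'a set" where
  "ideal_meet R I f = carrier R \<inter> (\<Inter>i\<in>I. f i)"

lemma ideal_meet_empty [simp]: "ideal_meet R {} f = carrier R"
  by (simp add: ideal_meet_def)

lemma ideal_meet_insert: "ideal_meet R (insert i I) f = f i \<inter> ideal_meet R I f"
  by (auto simp: ideal_meet_def)

lemma ideal_meet_image: "ideal_meet R (g ` I) f = ideal_meet R I (\<lambda>i. f (g i))"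
  by (simp add: ideal_meet_def)

lemma ideal_meet_mono:
  assumes "\<And>i. i \<in> I \<Longrightarrow> f i \<subseteq> g i"
  shows "ideal_meet R I f \<subseteq> ideal_meet R I g"
  using assms by (auto simp: ideal_meet_def)

lemma ideal_meet_antimono: "J \<subseteq> I \<Longrightarrow> ideal_meet R I f \<subseteq> ideal_meet R J f"
  by (auto simp: ideal_meet_def)

lemma ideal_prod_mono:
  assumes "I \<subseteq> I'" "J \<subseteq> J'"
  shows "I \<cdot>\<^bsub>R\<^esub> J \<subseteq> I' \<cdot>\<^bsub>R\<^esub> J'"
proof
  fix s assume "s \<in> I \<cdot>\<^bsub>R\<^esub> J"
  then show "s \<in> I' \<cdot>\<^bsub>R\<^esub> J'"
    by induct (use assms in \<open>auto intro: ideal_prod.intros\<close>)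
qed

lemma ideals_set_one [simp]: "\<one>\<^bsub>ideals_set R\<^esub> = carrier R"
  and ideals_set_mult [simp]: "I \<otimes>\<^bsub>ideals_set R\<^esub> J = I \<cdot>\<^bsub>R\<^esub> J"
  by (simp_all add: ideals_set_def)

section \<open>Products and powers of two-sided ideals\<close>

context ring
begin

lemma ideal_subset_carrier: "ideal I R \<Longrightarrow> I \<subseteq> carrier R"
  by (auto dest: ideal.Icarr)

lemma ideal_meet_ideal:
  assumes "\<And>i. i \<in> I \<Longrightarrow> ideal (f i) R"
  shows "ideal (ideal_meet R I f) R"
proof -
  have "ideal_meet R I f = \<Inter> (insert (carrier R) (f ` I))"
    by (auto simp: ideal_meet_def)
  moreover have "ideal (\<Inter> (insert (carrier R) (f ` I))) R"
    by (rule i_Intersect) (use assms oneideal in auto)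
  ultimately show ?thesis by simp
qed

lemma ideal_one_prod:
  assumes "ideal I R"
  shows "carrier R \<cdot> I = I"
proof
  show "carrier R \<cdot> I \<subseteq> I"
    using ideal_prod_inter[OF oneideal assms] by blast
  show "I \<subseteq> carrier R \<cdot> I"
    by (metis assms ideal.Icarr ideal_prod.prod l_one one_closed subsetI)
qed

text \<open>Multiplication of ideals is associative with unit \<open>carrier R\<close> even when
  \<open>R\<close> is not commutative. The laws for sums and products of exponents are then those of
  powers in a monoid.\<close>

lemma ideals_monoid: "monoid (ideals_set R)"
  by (rule monoidI)
    (auto simp: ideals_set_def ideal_prod_is_ideal ideal_prod_assoc ideal_one_prod
      ideal_prod_one oneideal)

lemma ideal_pow_ideal:
  assumes "ideal I R" shows "ideal (ideal_pow R I k) R"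
  using monoid.nat_pow_closed[OF ideals_monoid, of I k] assms by (simp add: ideals_set_def)

lemma ideal_pow_1: "ideal I R \<Longrightarrow> ideal_pow R I 1 = I"
  by (simp add: ideal_one_prod)

lemma ideal_pow_add:
  assumes "ideal I R"
  shows "ideal_pow R I m \<cdot> ideal_pow R I n = ideal_pow R I (m + n)"
  using monoid.nat_pow_mult[OF ideals_monoid, of I m n] assms by (simp add: ideals_set_def)

lemma ideal_pow_pow:
  assumes "ideal I R"
  shows "ideal_pow R (ideal_pow R I m) n = ideal_pow R I (m * n)"
  using monoid.nat_pow_pow[OF ideals_monoid, of I m n] assms by (simp add: ideals_set_def)

lemma ideal_pow_antimono:
  assumes "ideal I R" "m \<le> n"
  shows "ideal_pow R I n \<subseteq> ideal_pow R I m"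
proof -
  obtain d where n: "n = m + d"
    using assms(2) le_Suc_ex by blast
  show ?thesis
    using ideal_prod_inter[OF ideal_pow_ideal[OF assms(1)] ideal_pow_ideal[OF assms(1)], of m d]
    by (auto simp: n ideal_pow_add[OF assms(1), symmetric])
qed

lemma ideal_pow_mono:
  assumes "I \<subseteq> J"
  shows "ideal_pow R I k \<subseteq> ideal_pow R J k"
  by (induction k) (simp_all add: ideal_prod_mono assms)

lemma ideal_meet_pow_antimono:
  assumes "\<And>I. I \<in> T \<Longrightarrow> ideal I R" "T \<subseteq> S" "m \<le> n"
  shows "ideal_meet R S (\<lambda>I. ideal_pow R I n) \<subseteq> ideal_meet R T (\<lambda>I. ideal_pow R I m)"
proof -
  have "ideal_meet R T (\<lambda>I. ideal_pow R I n) \<subseteq> ideal_meet R T (\<lambda>I. ideal_pow R I m)"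
    using assms(1,3) by (intro ideal_meet_mono ideal_pow_antimono)
  with ideal_meet_antimono[OF assms(2)] show ?thesis
    by (rule order.trans)
qed

section \<open>Comaximal ideals\<close>

lemma comaximal_iff:
  assumes "ideal I R" "ideal J R"
  shows "comaximal R I J \<longleftrightarrow> (\<exists>a\<in>I. \<exists>b\<in>J. a \<oplus> b = \<one>)"
proof
  assume "comaximal R I J"
  then have "\<one> \<in> I <+>\<^bsub>R\<^esub> J"
    by (simp add: comaximal_def)
  then show "\<exists>a\<in>I. \<exists>b\<in>J. a \<oplus> b = \<one>"
    unfolding set_add_def' by force
next
  assume "\<exists>a\<in>I. \<exists>b\<in>J. a \<oplus> b = \<one>"
  then have "\<one> \<in> I <+>\<^bsub>R\<^esub> J"
    unfolding set_add_def' by force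
  then show "comaximal R I J"
    unfolding comaximal_def
    by (rule ideal.one_imp_carrier[OF add_ideals[OF assms]])
qed

lemma comaximal_sym:
  assumes "ideal I R" "ideal J R"
  shows "comaximal R I J \<Longrightarrow> comaximal R J I"
  by (simp add: comaximal_def set_add_comm assms ideal_subset_carrier)

lemma comaximal_mono:
  assumes "ideal I R" "ideal J R" "ideal J' R" "comaximal R I J" "J \<subseteq> J'"
  shows "comaximal R I J'"
  using assms by (auto simp: comaximal_iff)

text \<open>If \<open>a \<oplus> b = \<one>\<close> and \<open>c \<oplus> d = \<one>\<close>, then
  \<open>\<one>\<close> is the sum of \<open>a \<oplus> b \<otimes> c\<close> in \<open>I\<close>
  and \<open>b \<otimes> d\<close> in the product. Only left multiplication is applied to
  \<open>c\<close>, so no commutativity enters.\<close>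

lemma comaximal_prod:
  assumes "ideal I R" "ideal J R" "ideal K R" "comaximal R I J" "comaximal R I K"
  shows "comaximal R I (J \<cdot> K)"
proof -
  obtain a b where ab: "a \<in> I" "b \<in> J" "a \<oplus> b = \<one>"
    using assms by (auto simp: comaximal_iff)
  obtain c d where cd: "c \<in> I" "d \<in> K" "c \<oplus> d = \<one>"
    using assms by (auto simp: comaximal_iff)
  have carr: "a \<in> carrier R" "b \<in> carrier R" "c \<in> carrier R" "d \<in> carrier R"
    using ab cd assms(1-3) by (auto dest: ideal.Icarr)
  have "(a \<oplus> b \<otimes> c) \<oplus> b \<otimes> d = a \<oplus> b \<otimes> (c \<oplus> d)"
    using carr by (simp add: r_distr a_assoc)
  then have "(a \<oplus> b \<otimes> c) \<oplus> b \<otimes> d = \<one>"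
    using ab cd carr by simp
  moreover have "a \<oplus> b \<otimes> c \<in> I"
    using ab cd carr assms(1)
    by (simp add: ideal.I_l_closed additive_subgroup.a_closed ideal.axioms(1))
  ultimately show ?thesis
    using ab cd assms by (auto simp: comaximal_iff ideal_prod_is_ideal intro: ideal_prod.prod)
qed

lemma comaximal_carrier: "ideal I R \<Longrightarrow> comaximal R I (carrier R)"
  using additive_subgroup.zero_closed[OF ideal.axioms(1)]
  by (force simp: comaximal_iff oneideal)

lemma comaximal_pow_right:
  assumes "ideal I R" "ideal J R" "comaximal R I J"
  shows "comaximal R I (ideal_pow R J k)"
  by (induction k)
    (simp_all add: comaximal_carrier comaximal_prod assms ideal_pow_ideal
     )

lemma comaximal_pow:
  assumes "ideal I R" "ideal J R" "comaximal R I J"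
  shows "comaximal R (ideal_pow R I m) (ideal_pow R J n)"
  using assms by (meson comaximal_sym comaximal_pow_right ideal_pow_ideal)

text \<open>The product of \<open>f j\<close> with the meet of the rest lies inside their
  intersection, so comaximality passes from the product to the larger meet.\<close>

lemma comaximal_ideal_meet:
  assumes "finite S" "ideal I R" "\<And>j. j \<in> S \<Longrightarrow> ideal (f j) R"
    and "\<And>j. j \<in> S \<Longrightarrow> comaximal R I (f j)"
  shows "comaximal R I (ideal_meet R S f)"
  using assms(1,3,4)
proof (induction S)
  case empty
  then show ?case by (simp add: comaximal_carrier assms(2))
next
  case (insert j S)
  have id: "ideal (f j) R" "ideal (ideal_meet R S f) R" "ideal (ideal_meet R (insert j S) f) R"
    using insert.prems by (auto intro: ideal_meet_ideal)
  have "comaximal R I (f j \<cdot> ideal_meet R S f)"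
    using insert id by (intro comaximal_prod assms(2)) auto
  moreover have "f j \<cdot> ideal_meet R S f \<subseteq> ideal_meet R (insert j S) f"
    using ideal_prod_inter[OF id(1,2)] by (simp add: ideal_meet_insert)
  ultimately show ?case
    using comaximal_mono id assms(2) ideal_prod_is_ideal by blast
qed

section \<open>Prime ideals and Noetherian induction\<close>

lemma prime_ideal_pow_le:
  assumes "prime_ideal R Q" "ideal P R" "ideal_pow R P k \<subseteq> Q"
  shows "P \<subseteq> Q"
  using assms(3)
proof (induction k)
  \<comment> \<open>The zeroth power is \<open>carrier R\<close>, which cannot lie in the proper
    ideal \<open>Q\<close>.\<close>
  case 0
  then show ?case using assms(1) ideal_subset_carrier[of Q] by (auto simp: prime_ideal_def)
next
  case (Suc k)
  then have "ideal_pow R P k \<subseteq> Q \<or> P \<subseteq> Q"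
    using assms(1,2) ideal_pow_ideal unfolding prime_ideal_def by auto
  with Suc.IH show ?case by blast
qed

lemma prime_ideal_meet_le:
  assumes "prime_ideal R Q" "finite S" "\<And>i. i \<in> S \<Longrightarrow> ideal (f i) R" "ideal_meet R S f \<subseteq> Q"
  shows "\<exists>i\<in>S. f i \<subseteq> Q"
  using assms(2-4)
proof (induction S)
  case empty
  then show ?case using assms(1) ideal_subset_carrier[of Q] by (auto simp: prime_ideal_def)
next
  case (insert j S)
  have id: "ideal (f j) R" "ideal (ideal_meet R S f) R"
    using insert.prems by (auto intro: ideal_meet_ideal)
  have "f j \<cdot> ideal_meet R S f \<subseteq> Q"
    using ideal_prod_inter[OF id] insert.prems(2) unfolding ideal_meet_insert by blast
  then have "f j \<subseteq> Q \<or> ideal_meet R S f \<subseteq> Q"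
    using assms(1) id unfolding prime_ideal_def by blast
  then show ?case using insert by auto
qed

text \<open>Larger ideals come first in this relation, so an infinite descent would be a strictly
  ascending chain. It carries the Noetherian induction on ideals.\<close>

lemma acc_on_ideals_wf:
  assumes "acc_on_ideals R"
  shows "wf {(B, A). ideal A R \<and> ideal B R \<and> A \<subset> B}"
  unfolding wf_iff_no_infinite_down_chain
proof clarify
  fix A assume "\<forall>i. (A (Suc i), A i) \<in> {(B, A). ideal A R \<and> ideal B R \<and> A \<subset> B}"
  then have A: "\<And>i. ideal (A i) R" "\<And>i. A i \<subset> A (Suc i)" by auto
  have "\<exists>N. \<forall>n\<ge>N. A n = A N"
    using assms A unfolding acc_on_ideals_def by (metis psubset_imp_subset)
  then obtain N where "A (Suc N) = A N" by (meson le_SucI order.refl)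
  with A(2)[of N] show False by simp
qed

text \<open>On expanding a product of two sums, every term except the one from
  \<open>B \<cdot> C\<close> has a factor in \<open>A\<close>. This replaces a failure of primeness
  of \<open>A\<close> by two ideals above \<open>A\<close> whose product falls into
  \<open>A\<close>.\<close>

lemma prod_add_ideals_subset:
  assumes "ideal A R" "ideal B R" "ideal C R" "B \<cdot> C \<subseteq> A"
  shows "(A <+>\<^bsub>R\<^esub> B) \<cdot> (A <+>\<^bsub>R\<^esub> C) \<subseteq> A"
proof
  fix s assume "s \<in> (A <+>\<^bsub>R\<^esub> B) \<cdot> (A <+>\<^bsub>R\<^esub> C)"
  then show "s \<in> A"
  proof induct
    case (prod i j)
    then obtain a b a' c where e: "a \<in> A" "b \<in> B" "i = a \<oplus> b" "a' \<in> A" "c \<in> C" "j = a' \<oplus> c"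
      unfolding set_add_def' by auto
    have carr: "a \<in> carrier R" "b \<in> carrier R" "a' \<in> carrier R" "c \<in> carrier R"
      using e assms(1-3) by (auto dest: ideal.Icarr)
    have "i \<otimes> j = a \<otimes> (a' \<oplus> c) \<oplus> (b \<otimes> a' \<oplus> b \<otimes> c)"
      using carr by (simp add: e l_distr r_distr a_ac)
    moreover have "b \<otimes> c \<in> A"
      using e assms(4) by (auto intro: ideal_prod.prod)
    ultimately show ?case
      using assms(1) carr e
      by (simp add: ideal.I_l_closed ideal.I_r_closed additive_subgroup.a_closed ideal.axioms(1))
  next
    case (sum s1 s2)
    then show ?case
      using assms(1) by (simp add: additive_subgroup.a_closed ideal.axioms(1))
  qed
qed

end

section \<open>Intersections of prime powers\<close>

text \<open>The condition on \<open>A\<close> and \<open>B\<close> is of Artin-Rees type. The chain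
  condition is kept out of the locale and assumed separately where it is used.\<close>

locale artin_rees_ring = ring +
  assumes artin_rees: "\<lbrakk>ideal A R; ideal B R\<rbrakk> \<Longrightarrow>
    \<exists>k::nat. 0 < k \<and> ideal_pow R A k \<inter> ideal_pow R B k \<subseteq> A \<cdot> B"
begin

text \<open>Induction on \<open>m\<close>: if \<open>k\<close> serves for \<open>m\<close>, then
  \<open>I^k J^k\<close> times \<open>I J\<close> lies in the power \<open>Suc m\<close> of the
  intersection. The work is to find a product of a power of \<open>I\<close> and a power of
  \<open>J\<close> inside \<open>I^k J^k I J\<close>, and then an intersection of powers inside that
  product.\<close>

lemma inter_pow_cofinal:
  assumes I: "ideal I R" and J: "ideal J R"
  shows "\<exists>k. ideal_pow R I k \<inter> ideal_pow R J k \<subseteq> ideal_pow R (I \<inter> J) m"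
proof (induction m)
  case 0
  show ?case
    using ideal_subset_carrier[OF ideal_pow_ideal[OF I]] by (auto intro: le_infI1)
next
  case (Suc m)
  let ?p = "ideal_pow R"
  note pid = ideal_pow_ideal[OF I] ideal_pow_ideal[OF J]
  obtain k where k: "?p I k \<inter> ?p J k \<subseteq> ?p (I \<inter> J) m"
    using Suc by blast
  \<comment> \<open>The condition for \<open>J^k\<close> and \<open>I\<close>, in this order, gives
    \<open>t\<close> with \<open>I^t J^(k*t)\<close> inside \<open>J^k I\<close>. This stands in for
    commuting \<open>I\<close> past \<open>J\<close>.\<close>
  obtain t where t: "?p (?p J k) t \<inter> ?p I t \<subseteq> ?p J k \<cdot> I"
    using artin_rees[OF pid(2) I] by blast
  \<comment> \<open>The exponents are chosen so that the product regroups as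
    \<open>I^k (I^t J^(k*t)) J\<close>, with the swappable factor in the middle.\<close>
  obtain s where s: "?p (?p I (k + t)) s \<inter> ?p (?p J (k * t + 1)) s \<subseteq> ?p I (k + t) \<cdot> ?p J (k * t + 1)"
    using artin_rees[OF pid] by blast
  have 1: "?p I t \<cdot> ?p J (k * t) \<subseteq> ?p J k \<cdot> I"
    using t ideal_prod_inter[OF pid, of t "k * t"] unfolding ideal_pow_pow[OF J] by blast
  have "?p I (k + t) \<cdot> ?p J (k * t + 1) = ?p I k \<cdot> ((?p I t \<cdot> ?p J (k * t)) \<cdot> J)"
    by (simp only: ideal_pow_add[OF I, symmetric] ideal_pow_add[OF J, symmetric] ideal_pow_1[OF J]
        ideal_prod_assoc pid I J ideal_prod_is_ideal)
  also have "\<dots> \<subseteq> ?p I k \<cdot> ((?p J k \<cdot> I) \<cdot> J)"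
    by (intro ideal_prod_mono 1 order.refl)
  also have "\<dots> = (?p I k \<cdot> ?p J k) \<cdot> (I \<cdot> J)"
    by (simp only: ideal_prod_assoc pid I J ideal_prod_is_ideal)
  also have "\<dots> \<subseteq> ?p (I \<inter> J) m \<cdot> (I \<inter> J)"
    using k ideal_prod_inter[OF pid, of k k] ideal_prod_inter[OF I J]
    by (intro ideal_prod_mono) blast+
  also have "\<dots> = ?p (I \<inter> J) (Suc m)"
    by simp
  finally have "?p I ((k + t) * s) \<inter> ?p J ((k * t + 1) * s) \<subseteq> ?p (I \<inter> J) (Suc m)"
    using s by (simp only: ideal_pow_pow I J)
  \<comment> \<open>The sum of the two exponents dominates both, which gives one exponent for
    \<open>I\<close> and \<open>J\<close>.\<close>
  then have "?p I ((k + t) * s + (k * t + 1) * s) \<inter> ?p J ((k + t) * s + (k * t + 1) * s)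
      \<subseteq> ?p (I \<inter> J) (Suc m)"
    using ideal_pow_antimono[OF I] ideal_pow_antimono[OF J]
    by (meson Int_mono le_add1 le_add2 order.trans)
  then show ?case by blast
qed

lemma ideal_meet_pow_cofinal:
  assumes "finite S" "\<And>I. I \<in> S \<Longrightarrow> ideal I R"
  shows "\<exists>k. ideal_meet R S (\<lambda>I. ideal_pow R I k)
    \<subseteq> ideal_pow R (ideal_meet R S (\<lambda>I. ideal_pow R I n)) m"
  using assms
\<comment> \<open>\<open>m\<close> must vary: the step applies the induction hypothesis at the
  exponent \<open>a\<close> that the two-ideal case demands.\<close>
proof (induction S arbitrary: m)
  case empty
  have "ideal_pow R (carrier R) j = carrier R" for j
    by (induction j) (simp_all add: ideal_prod_one oneideal)
  then show ?case by simp
next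
  case (insert I S)
  let ?p = "ideal_pow R"
  let ?X = "\<lambda>S n. ideal_meet R S (\<lambda>I. ?p I n)"
  have I: "ideal I R" using insert.prems by simp
  have X: "ideal (?X S k) R" for k
    using insert.prems by (intro ideal_meet_ideal ideal_pow_ideal) auto
  obtain a where a: "?p (?p I n) a \<inter> ?p (?X S n) a \<subseteq> ?p (?p I n \<inter> ?X S n) m"
    using inter_pow_cofinal[OF ideal_pow_ideal[OF I] X] by blast
  obtain k where k: "?X S k \<subseteq> ?p (?X S n) a"
    using insert by blast
  have "?X S (k + n * a) \<subseteq> ?X S k"
    using insert.prems by (intro ideal_meet_pow_antimono) auto
  moreover have "?p I (k + n * a) \<subseteq> ?p I (n * a)"
    by (intro ideal_pow_antimono I) simp
  ultimately have "?X (insert I S) (k + n * a) \<subseteq> ?p (?X (insert I S) n) m"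
    using a k unfolding ideal_meet_insert ideal_pow_pow[OF I] by blast
  then show ?case by blast
qed

text \<open>If \<open>A\<close> is neither prime nor the whole ring, it contains a product
  \<open>B \<cdot> C\<close> with neither factor inside \<open>A\<close>. The sums of
  \<open>A\<close> with \<open>B\<close> and with \<open>C\<close> are strictly larger, so each
  contains a meet of prime powers. The Artin-Rees condition and cofinality carry both meets down to
  one inside \<open>A\<close>. The whole ring is handled by the empty set of primes.\<close>

lemma ex_prime_powers_below:
  assumes acc: "acc_on_ideals R" and "ideal A R"
  shows "\<exists>S n. finite S \<and> (\<forall>P\<in>S. prime_ideal R P) \<and>
    ideal_meet R S (\<lambda>P. ideal_pow R P n) \<subseteq> A"
  using acc_on_ideals_wf[OF acc] assms(2)
proof (induction A rule: wf_induct_rule)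
  case (less A)
  let ?p = "ideal_pow R"
  let ?X = "\<lambda>S n. ideal_meet R S (\<lambda>I. ?p I n)"
  show ?case
  proof (cases "A = carrier R \<or> prime_ideal R A")
    case True
    then show ?thesis
    proof
      assume "A = carrier R"
      then have "finite {} \<and> (\<forall>P\<in>{}. prime_ideal R P) \<and> ?X {} 0 \<subseteq> A" by simp
      then show ?thesis by blast
    next
      assume "prime_ideal R A"
      then have "finite {A} \<and> (\<forall>P\<in>{A}. prime_ideal R P) \<and> ?X {A} 1 \<subseteq> A"
        using ideal_pow_1[OF less.prems] by (auto simp: ideal_meet_def)
      then show ?thesis by blast
    qed
  next
    case False
    then obtain B C where BC: "ideal B R" "ideal C R" "B \<cdot> C \<subseteq> A" "\<not> B \<subseteq> A" "\<not> C \<subseteq> A"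
      using less.prems unfolding prime_ideal_def by blast
    have sup: "A \<subset> A <+>\<^bsub>R\<^esub> D \<and> ideal (A <+>\<^bsub>R\<^esub> D) R" if "ideal D R" "\<not> D \<subseteq> A" for D
    proof -
      have z: "\<zero> \<in> A" "\<zero> \<in> D"
        using less.prems that(1) by (auto intro: additive_subgroup.zero_closed ideal.axioms(1))
      have "x \<in> A <+>\<^bsub>R\<^esub> D" if "x \<in> A" for x
        using that z ideal.Icarr[OF less.prems that] unfolding set_add_def' by force
      moreover have "x \<in> A <+>\<^bsub>R\<^esub> D" if "x \<in> D" for x
        using that z ideal.Icarr[OF \<open>ideal D R\<close> that] unfolding set_add_def' by force
      ultimately show ?thesis
        using that add_ideals[OF less.prems that(1)] by blast
    qed
    have IH: "\<exists>S n. finite S \<and> (\<forall>P\<in>S. prime_ideal R P) \<and> ?X S n \<subseteq> A <+>\<^bsub>R\<^esub> D"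
      if "ideal D R" "\<not> D \<subseteq> A" for D
      using sup[OF that] less.prems by (intro less.IH) auto
    obtain S m where S: "finite S" "\<forall>P\<in>S. prime_ideal R P" "?X S m \<subseteq> A <+>\<^bsub>R\<^esub> B"
      using IH BC by meson
    obtain T n where T: "finite T" "\<forall>P\<in>T. prime_ideal R P" "?X T n \<subseteq> A <+>\<^bsub>R\<^esub> C"
      using IH BC by meson
    have idST: "ideal P R" if "P \<in> S \<union> T" for P
      using that S(2) T(2) by (auto simp: prime_ideal_def)
    \<comment> \<open>The product of the two sums lies in \<open>A\<close>, so the Artin-Rees
      condition puts the intersection of suitable powers there too.\<close>
    obtain k where k: "?p (A <+>\<^bsub>R\<^esub> B) k \<inter> ?p (A <+>\<^bsub>R\<^esub> C) k \<subseteq> A"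
      using artin_rees[of "A <+>\<^bsub>R\<^esub> B" "A <+>\<^bsub>R\<^esub> C"] sup BC prod_add_ideals_subset[OF less.prems BC(1-3)]
      by (meson order.trans)
    \<comment> \<open>Raising the prime exponents to \<open>a\<close> forces the meet into the
      \<open>k\<close>-th power of \<open>?X S m\<close>, hence into the \<open>k\<close>-th power
      of the first sum.\<close>
    obtain a where a: "?X S a \<subseteq> ?p (?X S m) k"
      using ideal_meet_pow_cofinal[OF S(1)] idST by blast
    obtain b where b: "?X T b \<subseteq> ?p (?X T n) k"
      using ideal_meet_pow_cofinal[OF T(1)] idST by blast
    have "?X (S \<union> T) (a + b) \<subseteq> ?X S a"
      using idST by (intro ideal_meet_pow_antimono) auto
    moreover have "?X (S \<union> T) (a + b) \<subseteq> ?X T b"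
      using idST by (intro ideal_meet_pow_antimono) auto
    ultimately have "?X (S \<union> T) (a + b) \<subseteq> A"
      using a b k ideal_pow_mono[OF S(3), of k] ideal_pow_mono[OF T(3), of k] by blast
    then show ?thesis
      using S T by (intro exI[of _ "S \<union> T"] exI[of _ "a + b"]) auto
  qed
qed

text \<open>The zero ideal contains a meet of powers of a finite set \<open>S\<close> of primes.
  Every prime then contains a member of \<open>S\<close>, so all minimal primes belong to
  \<open>S\<close>. Conversely every member of \<open>S\<close> contains a minimal prime, so passing
  to minimal primes only shrinks the meet.\<close>

lemma minimal_primes_nilpotent:
  assumes "acc_on_ideals R"
  shows "finite {P. minimal_prime_ideal R P}"
    and "\<exists>n. ideal_meet R {P. minimal_prime_ideal R P} (\<lambda>P. ideal_pow R P n) = {\<zero>}"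
proof -
  let ?p = "ideal_pow R"
  let ?X = "\<lambda>S n. ideal_meet R S (\<lambda>I. ?p I n)"
  let ?Min = "{P. minimal_prime_ideal R P}"
  obtain S n where S: "finite S" "\<forall>P\<in>S. prime_ideal R P" "?X S n \<subseteq> {\<zero>}"
    using ex_prime_powers_below[OF assms zeroideal] by blast
  have id: "ideal P R" if "P \<in> S" for P
    using that S(2) by (auto simp: prime_ideal_def)
  have below: "\<exists>P\<in>S. P \<subseteq> Q" if Q: "prime_ideal R Q" for Q
  proof -
    have "ideal Q R"
      using Q by (simp add: prime_ideal_def)
    then have "\<zero> \<in> Q"
      by (intro additive_subgroup.zero_closed ideal.axioms(1))
    then have "?X S n \<subseteq> Q" using S(3) by auto
    then have "\<exists>P\<in>S. ?p P n \<subseteq> Q"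
      using id by (intro prime_ideal_meet_le[OF Q S(1)] ideal_pow_ideal)
    then obtain P where P: "P \<in> S" "?p P n \<subseteq> Q" ..
    from prime_ideal_pow_le[OF Q id[OF P(1)] P(2)] P(1) show ?thesis ..
  qed
  have sub: "?Min \<subseteq> S"
  proof
    fix Q assume "Q \<in> ?Min"
    then have Q: "prime_ideal R Q" "\<And>P. prime_ideal R P \<Longrightarrow> P \<subseteq> Q \<Longrightarrow> P = Q"
      unfolding minimal_prime_ideal_def by blast+
    from below[OF Q(1)] obtain P where P: "P \<in> S" "P \<subseteq> Q" ..
    then show "Q \<in> S"
      using Q(2)[of P] S(2) by auto
  qed
  then show "finite ?Min"
    using finite_subset S(1) by auto
  \<comment> \<open>A minimal element of the finite set \<open>S\<close> is minimal among all
    primes, because by \<open>below\<close> each prime contains a member of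
    \<open>S\<close>.\<close>
  have minbelow: "\<exists>Q\<in>?Min. Q \<subseteq> P" if P: "P \<in> S" for P
  proof -
    obtain Q where Q: "Q \<in> S" "Q \<subseteq> P" "\<forall>Q'\<in>S. Q' \<subseteq> Q \<longrightarrow> Q = Q'"
      using finite_has_minimal2[OF S(1) P] by auto
    have "Q' = Q" if Q': "prime_ideal R Q'" "Q' \<subseteq> Q" for Q'
    proof -
      obtain Q'' where "Q'' \<in> S" "Q'' \<subseteq> Q'"
        using below[OF Q'(1)] by auto
      with Q(3) Q'(2) show ?thesis by blast
    qed
    with Q(1) S(2) have "minimal_prime_ideal R Q"
      unfolding minimal_prime_ideal_def by blast
    with Q show ?thesis by auto
  qed
  have "?X ?Min n \<subseteq> ?X S n"
  proof
    fix x assume x: "x \<in> ?X ?Min n"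
    have "x \<in> ?p P n" if P: "P \<in> S" for P
    proof -
      obtain Q where Q: "Q \<in> ?Min" "Q \<subseteq> P"
        using minbelow[OF P] by auto
      have "x \<in> ?p Q n"
        using x Q(1) by (simp add: ideal_meet_def)
      with ideal_pow_mono[OF Q(2)] show ?thesis by auto
    qed
    with x show "x \<in> ?X S n"
      by (simp add: ideal_meet_def)
  qed
  moreover have "ideal (?X ?Min n) R"
    using sub id by (intro ideal_meet_ideal ideal_pow_ideal) auto
  then have "\<zero> \<in> ?X ?Min n"
    by (intro additive_subgroup.zero_closed ideal.axioms(1))
  ultimately have "?X ?Min n = {\<zero>}"
    using S(3) by auto
  then show "\<exists>n. ?X ?Min n = {\<zero>}" ..
qed

end

section \<open>Decompositions of right modules\<close>

lemma sum_family_mono: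
  assumes "\<And>i. i \<in> I \<Longrightarrow> N i \<subseteq> N' i"
  shows "sum_family M I N \<subseteq> sum_family M I N'"
  using assms unfolding sum_family_def by blast

lemma sum_family_cong:
  assumes "\<And>i. i \<in> I \<Longrightarrow> N i = N' i"
  shows "sum_family M I N = sum_family M I N'"
  using assms by (intro equalityI sum_family_mono) auto

lemma is_direct_sum_cong:
  assumes "\<And>i. i \<in> I \<Longrightarrow> N i = N' i"
  shows "is_direct_sum R M I N \<longleftrightarrow> is_direct_sum R M I N'"
proof -
  \<comment> \<open>Stated for \<open>I - J\<close> to cover both the full sum, with
    \<open>J\<close> empty, and the sums that omit one index.\<close>
  have "sum_family M (I - J) N = sum_family M (I - J) N'" for J
    using assms by (intro sum_family_cong) auto
  from this[of "{}"] this show ?thesis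
    using assms by (simp add: is_direct_sum_def)
qed

context right_module
begin

section \<open>Module arithmetic and annihilators\<close>

lemma ract_zero_right [simp]:
  assumes "x \<in> carrier M" shows "x \<triangleleft>\<^bsub>M\<^esub> \<zero>\<^bsub>R\<^esub> = \<zero>\<^bsub>M\<^esub>"
proof -
  have "x \<triangleleft>\<^bsub>M\<^esub> \<zero>\<^bsub>R\<^esub> \<oplus>\<^bsub>M\<^esub> x \<triangleleft>\<^bsub>M\<^esub> \<zero>\<^bsub>R\<^esub> = x \<triangleleft>\<^bsub>M\<^esub> \<zero>\<^bsub>R\<^esub>"
    using ract_r_distr[OF assms R.zero_closed R.zero_closed] by simp
  then show ?thesis
    using assms by (metis M.add.r_cancel_one R.zero_closed ract_closed)
qed

lemma ract_zero_left [simp]: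
  assumes "a \<in> carrier R" shows "\<zero>\<^bsub>M\<^esub> \<triangleleft>\<^bsub>M\<^esub> a = \<zero>\<^bsub>M\<^esub>"
proof -
  have "\<zero>\<^bsub>M\<^esub> \<triangleleft>\<^bsub>M\<^esub> a \<oplus>\<^bsub>M\<^esub> \<zero>\<^bsub>M\<^esub> \<triangleleft>\<^bsub>M\<^esub> a = \<zero>\<^bsub>M\<^esub> \<triangleleft>\<^bsub>M\<^esub> a"
    using ract_l_distr[OF M.zero_closed M.zero_closed assms] by simp
  then show ?thesis
    using assms by (metis M.add.r_cancel_one M.zero_closed ract_closed)
qed

text \<open>With negation expressed by the action, a submodule criterion need not ask for closure
  under negatives.\<close>

lemma a_inv_eq_ract:
  assumes "x \<in> carrier M" shows "\<ominus>\<^bsub>M\<^esub> x = x \<triangleleft>\<^bsub>M\<^esub> (\<ominus>\<^bsub>R\<^esub> \<one>\<^bsub>R\<^esub>)"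
proof (rule M.minus_equality)
  have "x \<triangleleft>\<^bsub>M\<^esub> (\<ominus>\<^bsub>R\<^esub> \<one>\<^bsub>R\<^esub> \<oplus>\<^bsub>R\<^esub> \<one>\<^bsub>R\<^esub>) = \<zero>\<^bsub>M\<^esub>"
    using assms by (simp add: R.l_neg)
  then show "x \<triangleleft>\<^bsub>M\<^esub> (\<ominus>\<^bsub>R\<^esub> \<one>\<^bsub>R\<^esub>) \<oplus>\<^bsub>M\<^esub> x = \<zero>\<^bsub>M\<^esub>"
    using assms by (simp add: ract_r_distr)
qed (use assms in simp_all)

lemma right_submoduleI:
  assumes "N \<subseteq> carrier M" "\<zero>\<^bsub>M\<^esub> \<in> N"
    and "\<And>x y. \<lbrakk>x \<in> N; y \<in> N\<rbrakk> \<Longrightarrow> x \<oplus>\<^bsub>M\<^esub> y \<in> N"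
    and act: "\<And>x a. \<lbrakk>x \<in> N; a \<in> carrier R\<rbrakk> \<Longrightarrow> x \<triangleleft>\<^bsub>M\<^esub> a \<in> N"
  shows "right_submodule R M N"
proof -
  have "\<ominus>\<^bsub>M\<^esub> x \<in> N" if "x \<in> N" for x
    using act[OF that, of "\<ominus>\<^bsub>R\<^esub> \<one>\<^bsub>R\<^esub>"] a_inv_eq_ract[of x] that assms(1) by auto
  then have "subgroup N (add_monoid M)"
    using assms(1-3) by (intro subgroup.intro) (auto simp: a_inv_def)
  with act show ?thesis
    by (simp add: right_submodule_def)
qed

lemma right_submoduleD:
  assumes "right_submodule R M N"
  shows "N \<subseteq> carrier M" and "\<zero>\<^bsub>M\<^esub> \<in> N"
    and "\<And>x y. \<lbrakk>x \<in> N; y \<in> N\<rbrakk> \<Longrightarrow> x \<oplus>\<^bsub>M\<^esub> y \<in> N"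
    and "\<And>x a. \<lbrakk>x \<in> N; a \<in> carrier R\<rbrakk> \<Longrightarrow> x \<triangleleft>\<^bsub>M\<^esub> a \<in> N"
  using assms subgroup.subset[of N "add_monoid M"] subgroup.one_closed[of N "add_monoid M"]
    subgroup.m_closed[of N "add_monoid M"]
  by (auto simp: right_submodule_def)

lemma l_ann_antimono: "X \<subseteq> Y \<Longrightarrow> l_ann M Y \<subseteq> l_ann M X"
  by (auto simp: l_ann_def)

lemma zero_in_l_ann: "X \<subseteq> carrier R \<Longrightarrow> \<zero>\<^bsub>M\<^esub> \<in> l_ann M X"
  by (auto simp: l_ann_def)

text \<open>Annihilators grow along a decreasing chain, so two elements of the union lie in a common
  annihilator and can be added there. A constant chain yields single annihilators, a chain of powers
  yields components.\<close>

lemma l_ann_UN_submodule: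
  fixes X :: "nat \<Rightarrow> 'a set"
  assumes X: "\<And>k. ideal (X k) R" and anti: "\<And>m n. m \<le> n \<Longrightarrow> X n \<subseteq> X m"
  shows "right_submodule R M (\<Union>k. l_ann M (X k))"
proof (rule right_submoduleI)
  show "(\<Union>k. l_ann M (X k)) \<subseteq> carrier M"
    by (auto simp: l_ann_def)
  show "\<zero>\<^bsub>M\<^esub> \<in> (\<Union>k. l_ann M (X k))"
    using zero_in_l_ann ideal_subset_carrier[OF X] by blast
next
  fix x y assume "x \<in> (\<Union>k. l_ann M (X k))" "y \<in> (\<Union>k. l_ann M (X k))"
  then obtain m n where "x \<in> l_ann M (X m)" "y \<in> l_ann M (X n)"
    by blast
  then have "x \<in> l_ann M (X (max m n))" "y \<in> l_ann M (X (max m n))"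
    using l_ann_antimono[OF anti[of m "max m n"]] l_ann_antimono[OF anti[of n "max m n"]] by auto
  then have "x \<oplus>\<^bsub>M\<^esub> y \<in> l_ann M (X (max m n))"
    using ideal.Icarr[OF X] by (auto simp: l_ann_def ract_l_distr)
  then show "x \<oplus>\<^bsub>M\<^esub> y \<in> (\<Union>k. l_ann M (X k))"
    by blast
next
  fix x a assume "x \<in> (\<Union>k. l_ann M (X k))" and a: "a \<in> carrier R"
  then obtain k where x: "x \<in> l_ann M (X k)"
    by blast
  \<comment> \<open>Moving \<open>a\<close> across gives \<open>a \<otimes> r\<close>, which stays
    in \<open>X k\<close> because the ideal is closed under left multiplication.\<close>
  have "(x \<triangleleft>\<^bsub>M\<^esub> a) \<triangleleft>\<^bsub>M\<^esub> r = \<zero>\<^bsub>M\<^esub>" if r: "r \<in> X k" for r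
    using x a r ideal.I_l_closed[OF X r a] ideal.Icarr[OF X r]
    by (auto simp: l_ann_def ract_assoc[symmetric])
  with x a have "x \<triangleleft>\<^bsub>M\<^esub> a \<in> l_ann M (X k)"
    by (auto simp: l_ann_def)
  then show "x \<triangleleft>\<^bsub>M\<^esub> a \<in> (\<Union>k. l_ann M (X k))"
    by blast
qed

lemma l_ann_submodule: "ideal X R \<Longrightarrow> right_submodule R M (l_ann M X)"
  using l_ann_UN_submodule[of "\<lambda>_. X"] by simp

text \<open>Splitting \<open>\<one>\<close> as \<open>a \<oplus> b\<close> makes \<open>m\<close> a
  sum of two zeros. This is the source of independence of the summands.\<close>

lemma l_ann_comaximal_trivial:
  assumes "ideal I R" "ideal J R" "comaximal R I J" "m \<in> l_ann M I" "m \<in> l_ann M J"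
  shows "m = \<zero>\<^bsub>M\<^esub>"
proof -
  obtain a b where "a \<in> I" "b \<in> J" "a \<oplus>\<^bsub>R\<^esub> b = \<one>\<^bsub>R\<^esub>"
    using assms(1-3) by (auto simp: comaximal_iff)
  moreover from this have "a \<in> carrier R" "b \<in> carrier R"
    using assms(1,2) by (auto dest: ideal.Icarr)
  ultimately have "m \<triangleleft>\<^bsub>M\<^esub> \<one>\<^bsub>R\<^esub> = \<zero>\<^bsub>M\<^esub>"
    using assms(4,5) ract_r_distr[of m a b] by (auto simp: l_ann_def)
  then show ?thesis
    using assms(4) by (simp add: l_ann_def)
qed

section \<open>Sums of families of submodules, and components\<close>

lemma sum_family_submodule:
  assumes "\<And>i. i \<in> I \<Longrightarrow> right_submodule R M (N i)"
  shows "right_submodule R M (sum_family M I N)"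
proof (rule right_submoduleI)
  note N = right_submoduleD[OF assms]
  have carr: "x j \<in> carrier M" if "j \<in> J" "J \<subseteq> I" "\<forall>j\<in>J. x j \<in> N j" for x j J
    using that N(1) by blast
  show "sum_family M I N \<subseteq> carrier M"
    using carr by (auto simp: sum_family_def intro!: M.finsum_closed)
  have "\<zero>\<^bsub>M\<^esub> = finsum M (\<lambda>_. \<zero>\<^bsub>M\<^esub>) {}" by simp
  then show "\<zero>\<^bsub>M\<^esub> \<in> sum_family M I N"
    unfolding sum_family_def by blast
  show "u \<oplus>\<^bsub>M\<^esub> v \<in> sum_family M I N"
    if uv: "u \<in> sum_family M I N" "v \<in> sum_family M I N" for u v
  proof -
    obtain x J where x: "u = finsum M x J" "finite J" "J \<subseteq> I" "\<forall>j\<in>J. x j \<in> N j"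
      using uv(1) unfolding sum_family_def by blast
    obtain y K where y: "v = finsum M y K" "finite K" "K \<subseteq> I" "\<forall>j\<in>K. y j \<in> N j"
      using uv(2) unfolding sum_family_def by blast
    \<comment> \<open>Both families are extended by zero to \<open>J \<union> K\<close>, where the
      two sums can be added term by term.\<close>
    define x' where "x' = (\<lambda>i. if i \<in> J then x i else \<zero>\<^bsub>M\<^esub>)"
    define y' where "y' = (\<lambda>i. if i \<in> K then y i else \<zero>\<^bsub>M\<^esub>)"
    have x'N: "x' i \<in> N i" if "i \<in> J \<union> K" for i
      using that x y N(2) by (auto simp: x'_def)
    have x': "x' i \<in> carrier M" if "i \<in> J \<union> K" for i
      using x'N[OF that] that x(3) y(3) N(1) by blast
    have y'N: "y' i \<in> N i" if "i \<in> J \<union> K" for i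
      using that x y N(2) by (auto simp: y'_def)
    have y': "y' i \<in> carrier M" if "i \<in> J \<union> K" for i
      using y'N[OF that] that x(3) y(3) N(1) by blast
    have "u = finsum M x' (J \<union> K)"
      unfolding x(1) by (rule M.add.finprod_mono_neutral_cong_left)
        (use x x' y in \<open>auto simp: x'_def\<close>)
    moreover have "v = finsum M y' (J \<union> K)"
      unfolding y(1) by (rule M.add.finprod_mono_neutral_cong_left)
        (use x y' y in \<open>auto simp: y'_def\<close>)
    ultimately have "u \<oplus>\<^bsub>M\<^esub> v = finsum M (\<lambda>i. x' i \<oplus>\<^bsub>M\<^esub> y' i) (J \<union> K)"
      using x' y' by (simp add: M.finsum_addf)
    moreover have "x' i \<oplus>\<^bsub>M\<^esub> y' i \<in> N i" if "i \<in> J \<union> K" for i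
      using that x'N y'N N(3) x(3) y(3) by blast
    ultimately show ?thesis
      unfolding sum_family_def using x(2,3) y(2,3)
      by (intro CollectI exI[of _ "\<lambda>i. x' i \<oplus>\<^bsub>M\<^esub> y' i"] exI[of _ "J \<union> K"]) auto
  qed
  show "u \<triangleleft>\<^bsub>M\<^esub> a \<in> sum_family M I N" if u: "u \<in> sum_family M I N" and a: "a \<in> carrier R" for u a
  proof -
    obtain x J where x: "u = finsum M x J" "finite J" "J \<subseteq> I" "\<forall>j\<in>J. x j \<in> N j"
      using u unfolding sum_family_def by blast
    from x(2-4) have "finsum M x J \<triangleleft>\<^bsub>M\<^esub> a = finsum M (\<lambda>i. x i \<triangleleft>\<^bsub>M\<^esub> a) J"
    proof induction
      case empty
      then show ?case using a by simp
    next
      case (insert j J)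
      then have "x j \<in> carrier M" "x \<in> J \<rightarrow> carrier M"
        using carr[of _ "insert j J" x] by auto
      with insert show ?case
        using a by (simp add: ract_l_distr Pi_iff)
    qed
    moreover have "\<forall>j\<in>J. x j \<triangleleft>\<^bsub>M\<^esub> a \<in> N j"
      using x(3,4) a N(4) by blast
    ultimately show ?thesis
      unfolding sum_family_def using x(1-3) by blast
  qed
qed

lemma sum_family_upper:
  assumes "i \<in> I" "N i \<subseteq> carrier M"
  shows "N i \<subseteq> sum_family M I N"
proof
  fix m assume m: "m \<in> N i"
  then have "m = finsum M (\<lambda>_. m) {i}"
    using assms(2) by auto
  with m assms(1) show "m \<in> sum_family M I N"
    unfolding sum_family_def by blast
qed

lemma sum_family_least:
  assumes Z: "right_submodule R M Z" and N: "\<And>i. i \<in> I \<Longrightarrow> N i \<subseteq> Z"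
  shows "sum_family M I N \<subseteq> Z"
proof
  fix m assume "m \<in> sum_family M I N"
  then obtain x J where x: "m = finsum M x J" "finite J" "J \<subseteq> I" "\<forall>j\<in>J. x j \<in> N j"
    unfolding sum_family_def by blast
  note Z = right_submoduleD[OF Z]
  from x(2-4) have "finsum M x J \<in> Z"
  proof induction
    case (insert j J)
    then have "x j \<in> Z" "x \<in> J \<rightarrow> Z"
      using N by auto
    then have "x j \<in> carrier M" "x \<in> J \<rightarrow> carrier M"
      using Z(1) by auto
    with insert \<open>x j \<in> Z\<close> show ?case
      using Z(3) by simp
  qed (simp add: Z(2))
  with x(1) show "m \<in> Z" by simp
qed

text \<open>The powers decrease, so their annihilators form an ascending chain, and the sum of such
  a chain is its union.\<close>

lemma component_eq_UN:
  assumes "ideal X R"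
  shows "component R M X = (\<Union>k. l_ann M (ideal_pow R X k))"
proof
  have sub: "right_submodule R M (\<Union>k. l_ann M (ideal_pow R X k))"
    by (intro l_ann_UN_submodule ideal_pow_ideal ideal_pow_antimono assms)
  show "component R M X \<subseteq> (\<Union>k. l_ann M (ideal_pow R X k))"
    unfolding component_def by (rule sum_family_least[OF sub]) blast
  show "(\<Union>k. l_ann M (ideal_pow R X k)) \<subseteq> component R M X"
  proof
    fix m assume "m \<in> (\<Union>k. l_ann M (ideal_pow R X k))"
    then obtain k where "m \<in> l_ann M (ideal_pow R X k)"
      by blast
    \<comment> \<open>The component is summed over exponents from 1 on; passing to
      \<open>Suc k\<close> also covers \<open>k = 0\<close>.\<close>
    then have "m \<in> l_ann M (ideal_pow R X (Suc k))"
      using l_ann_antimono[OF ideal_pow_antimono[OF assms, of k "Suc k"]] by auto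
    moreover have "l_ann M (ideal_pow R X (Suc k)) \<subseteq> component R M X"
      unfolding component_def by (rule sum_family_upper) (auto simp: l_ann_def)
    ultimately show "m \<in> component R M X"
      by blast
  qed
qed

section \<open>Decomposition along pairwise comaximal ideals\<close>

text \<open>Splitting off one ideal: if \<open>a \<oplus> b = \<one>\<close> with \<open>a \<in> f i\<close> and \<open>b\<close> in the meet of the others,
  then \<open>m b\<close> is killed by \<open>f i\<close> and \<open>m a\<close> by the meet of the others.\<close>

lemma l_ann_meet_subset_sum:
  assumes "finite S" "\<And>i. i \<in> S \<Longrightarrow> ideal (f i) R"
    and "\<And>i j. \<lbrakk>i \<in> S; j \<in> S; i \<noteq> j\<rbrakk> \<Longrightarrow> comaximal R (f i) (f j)"
  shows "l_ann M (ideal_meet R S f) \<subseteq> sum_family M S (\<lambda>i. l_ann M (f i))"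
  using assms
proof (induction S)
  case empty
  \<comment> \<open>The empty meet is the whole ring, which is comaximal with itself, so it
    annihilates only zero.\<close>
  have "m = \<zero>\<^bsub>M\<^esub>" if "m \<in> l_ann M (carrier R)" for m
    using l_ann_comaximal_trivial[OF oneideal oneideal comaximal_carrier[OF oneideal] that that] .
  moreover have "\<zero>\<^bsub>M\<^esub> \<in> sum_family M {} (\<lambda>i. l_ann M (f i))"
    by (intro right_submoduleD(2) sum_family_submodule) auto
  ultimately show ?case by auto
next
  case (insert i S)
  let ?J = "ideal_meet R S f"
  let ?N = "\<lambda>i. l_ann M (f i)"
  have id: "ideal (f i) R" "ideal ?J R"
    using insert.prems by (auto intro: ideal_meet_ideal)
  have "comaximal R (f i) ?J"
    using insert.hyps insert.prems by (intro comaximal_ideal_meet) auto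
  then obtain a b where ab: "a \<in> f i" "b \<in> ?J" "a \<oplus>\<^bsub>R\<^esub> b = \<one>\<^bsub>R\<^esub>"
    using id by (auto simp: comaximal_iff)
  then have carr: "a \<in> carrier R" "b \<in> carrier R"
    using id by (auto dest: ideal.Icarr)
  have sub: "right_submodule R M (sum_family M (insert i S) ?N)"
    using insert.prems by (intro sum_family_submodule l_ann_submodule) auto
  show ?case
  proof
    fix m assume m: "m \<in> l_ann M (ideal_meet R (insert i S) f)"
    then have mM: "m \<in> carrier M" and kill: "\<And>r. \<lbrakk>r \<in> f i; r \<in> ?J\<rbrakk> \<Longrightarrow> m \<triangleleft>\<^bsub>M\<^esub> r = \<zero>\<^bsub>M\<^esub>"
      by (auto simp: l_ann_def ideal_meet_insert)
    \<comment> \<open>For \<open>r\<close> in \<open>?J\<close> the product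
      \<open>a \<otimes> r\<close> lies in both \<open>f i\<close> and \<open>?J\<close>, hence
      kills \<open>m\<close>. The roles are exchanged for \<open>b\<close>.\<close>
    have "m \<triangleleft>\<^bsub>M\<^esub> a \<in> l_ann M ?J"
      using ab(1) carr mM
      by (auto simp: l_ann_def ract_assoc[symmetric] ideal.Icarr[OF id(2)]
          intro!: kill ideal.I_r_closed[OF id(1)] ideal.I_l_closed[OF id(2)])
    then have "m \<triangleleft>\<^bsub>M\<^esub> a \<in> sum_family M S ?N"
      using insert by auto
    moreover have "sum_family M S ?N \<subseteq> sum_family M (insert i S) ?N"
      unfolding sum_family_def by blast
    moreover have "m \<triangleleft>\<^bsub>M\<^esub> b \<in> ?N i"
      using ab(2) carr mM
      by (auto simp: l_ann_def ract_assoc[symmetric] ideal.Icarr[OF id(1)]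
          intro!: kill ideal.I_l_closed[OF id(1)] ideal.I_r_closed[OF id(2)])
    moreover have "?N i \<subseteq> sum_family M (insert i S) ?N"
      by (rule sum_family_upper) (auto simp: l_ann_def)
    ultimately have "m \<triangleleft>\<^bsub>M\<^esub> a \<oplus>\<^bsub>M\<^esub> m \<triangleleft>\<^bsub>M\<^esub> b \<in> sum_family M (insert i S) ?N"
      by (intro right_submoduleD(3)[OF sub]) blast+
    then show "m \<in> sum_family M (insert i S) ?N"
      using ract_r_distr[OF mM carr] ab(3) mM by simp
  qed
qed

text \<open>The annihilators at the single level \<open>k\<close> already span, and the unions only
  enlarge them. Independence survives because it concerns one element at a time, and comaximality
  holds between all levels of different chains.\<close>

lemma direct_sum_of_comaximal_chains:
  fixes f :: "'i \<Rightarrow> nat \<Rightarrow> 'a set"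
  assumes S: "finite S" and f: "\<And>i k. i \<in> S \<Longrightarrow> ideal (f i k) R"
    and anti: "\<And>i m n. \<lbrakk>i \<in> S; m \<le> n\<rbrakk> \<Longrightarrow> f i n \<subseteq> f i m"
    and comax: "\<And>i j m n. \<lbrakk>i \<in> S; j \<in> S; i \<noteq> j\<rbrakk> \<Longrightarrow> comaximal R (f i m) (f j n)"
    and kill: "carrier M \<subseteq> l_ann M (ideal_meet R S (\<lambda>i. f i k))"
  shows "is_direct_sum R M S (\<lambda>i. \<Union>k. l_ann M (f i k))"
proof -
  let ?C = "\<lambda>i. \<Union>k. l_ann M (f i k)"
  have C: "right_submodule R M (?C i)" if "i \<in> S" for i
    using that by (intro l_ann_UN_submodule f anti)
  have "carrier M \<subseteq> sum_family M S (\<lambda>i. l_ann M (f i k))"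
    using kill l_ann_meet_subset_sum[of S "\<lambda>i. f i k", OF S f comax] by blast
  also have "\<dots> \<subseteq> sum_family M S ?C"
    by (intro sum_family_mono) blast
  finally have "sum_family M S ?C = carrier M"
    by (intro equalityI right_submoduleD(1) sum_family_submodule C)
  moreover have "?C i \<inter> sum_family M (S - {i}) ?C = {\<zero>\<^bsub>M\<^esub>}" if i: "i \<in> S" for i
  proof -
    \<comment> \<open>Each element of the sum of the other summands is killed by some
      \<open>?X q\<close>: the union of these annihilators is a submodule containing every other
      \<open>?C j\<close>.\<close>
    let ?X = "\<lambda>k. ideal_meet R (S - {i}) (\<lambda>j. f j k)"
    have X: "ideal (?X k) R" for k
      by (intro ideal_meet_ideal f) auto
    have "right_submodule R M (\<Union>k. l_ann M (?X k))"
      by (intro l_ann_UN_submodule X ideal_meet_mono anti) auto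
    moreover have "?C j \<subseteq> (\<Union>k. l_ann M (?X k))" if "j \<in> S - {i}" for j
      using that by (intro UN_mono l_ann_antimono) (auto simp: ideal_meet_def)
    ultimately have sum: "sum_family M (S - {i}) ?C \<subseteq> (\<Union>k. l_ann M (?X k))"
      by (rule sum_family_least)
    have "m = \<zero>\<^bsub>M\<^esub>" if m: "m \<in> ?C i" "m \<in> sum_family M (S - {i}) ?C" for m
    proof -
      obtain p q where pq: "m \<in> l_ann M (f i p)" "m \<in> l_ann M (?X q)"
        using m sum by blast
      have "comaximal R (f i p) (?X q)"
        using S i by (intro comaximal_ideal_meet f comax) auto
      with pq show ?thesis
        using l_ann_comaximal_trivial f[OF i] X by blast
    qed
    moreover have "\<zero>\<^bsub>M\<^esub> \<in> ?C i" "\<zero>\<^bsub>M\<^esub> \<in> sum_family M (S - {i}) ?C"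
      by (intro right_submoduleD(2) sum_family_submodule C; use i in simp)+
    ultimately show ?thesis by blast
  qed
  ultimately show ?thesis
    using C by (simp add: is_direct_sum_def)
qed

text \<open>With constant chains the unions are the annihilators themselves.\<close>

lemma direct_sum_of_comaximal:
  assumes "finite S" "\<And>i. i \<in> S \<Longrightarrow> ideal (f i) R"
    and "\<And>i j. \<lbrakk>i \<in> S; j \<in> S; i \<noteq> j\<rbrakk> \<Longrightarrow> comaximal R (f i) (f j)"
    and "carrier M \<subseteq> l_ann M (ideal_meet R S f)"
  shows "is_direct_sum R M S (\<lambda>i. l_ann M (f i))"
  using direct_sum_of_comaximal_chains[of S "\<lambda>i _. f i" 0] assms by simp

end

section \<open>The decompositions by minimal prime powers and by components\<close>

theorem theorem3p2:
  fixes R :: "('a, 'b) ring_scheme"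
    and M :: "('a, 'm, 'c) right_module_scheme"
  assumes "ring R"
    and "acc_on_ideals R"
    and "\<And>P P'. \<lbrakk>prime_ideal R P; prime_ideal R P'; incomparable P P'\<rbrakk> \<Longrightarrow> comaximal R P P'"
    and "\<And>A B. \<lbrakk>ideal A R; ideal B R\<rbrakk> \<Longrightarrow>
           \<exists>k::nat. 0 < k \<and> ideal_pow R A k \<inter> ideal_pow R B k \<subseteq> A \<cdot>\<^bsub>R\<^esub> B"
    and "right_module R M"
    and "carrier M \<noteq> {\<zero>\<^bsub>M\<^esub>}"
  shows "(r_ann R M (carrier M) \<noteq> {\<zero>\<^bsub>R\<^esub>} \<longrightarrow>
            (\<exists>(n::nat) (P :: nat \<Rightarrow> 'a set) (k :: nat \<Rightarrow> nat).
               1 \<le> n \<and> inj_on P {1..n} \<and>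
               (\<forall>i\<in>{1..n}. prime_ideal R (P i) \<and> 0 < k i) \<and>
               (\<Inter>i\<in>{1..n}. ideal_pow R (P i) (k i)) \<subseteq> r_ann R M (carrier M) \<and>
               (\<forall>i\<in>{1..n}. l_ann M (ideal_pow R (P i) (k i)) \<noteq> {\<zero>\<^bsub>M\<^esub>}) \<and>
               is_direct_sum R M {1..n} (\<lambda>i. l_ann M (ideal_pow R (P i) (k i)))))
       \<and> (\<forall>(I :: 'i set) (Q :: 'i \<Rightarrow> 'a set) (Y :: 'm set).
            bij_betw Q I {P. minimal_prime_ideal R P} \<longrightarrow>
            (\<exists>i\<in>I. \<exists>j\<in>I. i \<noteq> j) \<longrightarrow>
            generates R M Y \<longrightarrow>
            (\<forall>y\<in>Y. r_ann R M (cyclic_submodule R M y) \<noteq> {\<zero>\<^bsub>R\<^esub>}) \<longrightarrow>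
            is_direct_sum R M I (\<lambda>i. component R M (Q i)))"
proof -
  interpret right_module R M by (rule assms(5))
  interpret artin_rees_ring R
    by unfold_locales (rule assms(4))
  let ?Min = "{P. minimal_prime_ideal R P}"
  have prime: "prime_ideal R P" if "P \<in> ?Min" for P
    using that by (simp add: minimal_prime_ideal_def)
  have id: "ideal P R" if "P \<in> ?Min" for P
    using prime[OF that] by (simp add: prime_ideal_def)
  have comax: "comaximal R P P'" if PP': "P \<in> ?Min" "P' \<in> ?Min" "P \<noteq> P'" for P P'
  proof -
    \<comment> \<open>If one minimal prime contained another, minimality would make them
      equal.\<close>
    have "incomparable P P'"
      using PP' unfolding minimal_prime_ideal_def incomparable_def by blast
    then show ?thesis
      using prime PP' by (intro assms(3))
  qed
  have finMin: "finite ?Min"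
    by (rule minimal_primes_nilpotent(1)[OF assms(2)])
  obtain n0 where n0: "ideal_meet R ?Min (\<lambda>P. ideal_pow R P n0) = {\<zero>\<^bsub>R\<^esub>}"
    using minimal_primes_nilpotent(2)[OF assms(2)] by blast
  \<comment> \<open>The successor makes the exponent positive, as the conclusion demands, and the
    meet of the powers stays zero.\<close>
  define N where "N = Suc n0"
  let ?L = "\<lambda>P. l_ann M (ideal_pow R P N)"
  have "ideal_meet R ?Min (\<lambda>P. ideal_pow R P N) \<subseteq> {\<zero>\<^bsub>R\<^esub>}"
    unfolding n0[symmetric] N_def by (intro ideal_meet_pow_antimono id) auto
  then have kill: "carrier M \<subseteq> l_ann M (ideal_meet R ?Min (\<lambda>P. ideal_pow R P N))"
    by (auto simp: l_ann_def)
  have part1: "\<exists>(n::nat) (P :: nat \<Rightarrow> 'a set) (k :: nat \<Rightarrow> nat).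
               1 \<le> n \<and> inj_on P {1..n} \<and>
               (\<forall>i\<in>{1..n}. prime_ideal R (P i) \<and> 0 < k i) \<and>
               (\<Inter>i\<in>{1..n}. ideal_pow R (P i) (k i)) \<subseteq> r_ann R M (carrier M) \<and>
               (\<forall>i\<in>{1..n}. l_ann M (ideal_pow R (P i) (k i)) \<noteq> {\<zero>\<^bsub>M\<^esub>}) \<and>
               is_direct_sum R M {1..n} (\<lambda>i. l_ann M (ideal_pow R (P i) (k i)))"
  proof -
    define S where "S = {P \<in> ?Min. ?L P \<noteq> {\<zero>\<^bsub>M\<^esub>}}"
    have S: "finite S" "S \<subseteq> ?Min"
      using finMin by (auto simp: S_def)
    let ?X = "ideal_meet R S (\<lambda>P. ideal_pow R P N)"
    have X: "ideal ?X R"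
      using S(2) by (intro ideal_meet_ideal ideal_pow_ideal id) auto
    have "carrier M \<subseteq> sum_family M ?Min ?L"
      using kill l_ann_meet_subset_sum[of ?Min "\<lambda>P. ideal_pow R P N", OF finMin]
      by (meson comax comaximal_pow id ideal_pow_ideal order.trans)
    \<comment> \<open>For \<open>P\<close> in \<open>S\<close> the power of \<open>P\<close>
      contains \<open>?X\<close>, and for the other minimal primes \<open>?L P\<close> is zero. So
      the meet over \<open>S\<close> alone already kills \<open>M\<close>.\<close>
    also have "\<dots> \<subseteq> l_ann M ?X"
    proof (rule sum_family_least[OF l_ann_submodule[OF X]])
      fix P assume P: "P \<in> ?Min"
      show "?L P \<subseteq> l_ann M ?X"
      proof (cases "P \<in> S")
        case True
        then show ?thesis
          by (intro l_ann_antimono) (auto simp: ideal_meet_def)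
      next
        case False
        then have "?L P = {\<zero>\<^bsub>M\<^esub>}"
          using P by (simp add: S_def)
        then show ?thesis
          using zero_in_l_ann[OF ideal_subset_carrier[OF X]] by simp
      qed
    qed
    finally have killX: "carrier M \<subseteq> l_ann M ?X" .
    \<comment> \<open>Otherwise \<open>?X\<close> would be the whole ring and would kill
      \<open>M\<close>, which is nonzero.\<close>
    have "S \<noteq> {}"
    proof
      assume "S = {}"
      then have "m = \<zero>\<^bsub>M\<^esub>" if "m \<in> carrier M" for m
        using killX that l_ann_comaximal_trivial[OF oneideal oneideal comaximal_carrier[OF oneideal]]
        by auto
      then show False
        using assms(6) M.zero_closed by blast
    qed
    then have card: "1 \<le> card S"
      using S(1) by (simp add: Suc_le_eq card_gt_0_iff)
    obtain P where P: "bij_betw P {1..card S} S"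
      using ex_bij_betw_nat_finite_1[OF S(1)] by blast
    have inj: "inj_on P {1..card S}" and PS: "P ` {1..card S} = S"
      using P by (auto simp: bij_betw_def)
    have Pin: "P i \<in> S" "P i \<in> ?Min" if "i \<in> {1..card S}" for i
      using that PS S(2) by auto
    have meet: "ideal_meet R {1..card S} (\<lambda>i. ideal_pow R (P i) N) = ?X"
      using ideal_meet_image[of R P "{1..card S}"] unfolding PS by simp
    \<comment> \<open>The index set is nonempty, so the plain intersection lies in the ring and can
      be compared with \<open>ideal_meet\<close>.\<close>
    have "(\<Inter>i\<in>{1..card S}. ideal_pow R (P i) N) \<subseteq> carrier R"
      using card by (intro INF_lower2[of 1] ideal_subset_carrier ideal_pow_ideal id Pin(2)) auto
    then have "(\<Inter>i\<in>{1..card S}. ideal_pow R (P i) N) \<subseteq> ?X"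
      unfolding meet[symmetric] unfolding ideal_meet_def by (rule Int_greatest) (rule order.refl)
    also have "\<dots> \<subseteq> r_ann R M (carrier M)"
      using killX ideal_subset_carrier[OF X] by (auto simp: l_ann_def r_ann_def)
    finally have "(\<Inter>i\<in>{1..card S}. ideal_pow R (P i) N) \<subseteq> r_ann R M (carrier M)" .
    moreover have "is_direct_sum R M {1..card S} (\<lambda>i. ?L (P i))"
    proof (rule direct_sum_of_comaximal)
      show "comaximal R (ideal_pow R (P i) N) (ideal_pow R (P j) N)"
        if "i \<in> {1..card S}" "j \<in> {1..card S}" "i \<noteq> j" for i j
        using that inj Pin by (intro comaximal_pow id comax) (auto dest: inj_onD)
    qed (use killX meet in \<open>simp_all add: ideal_pow_ideal id Pin del: mem_Collect_eq\<close>)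
    ultimately show ?thesis
      using card inj prime Pin
      by (intro exI[of _ "card S"] exI[of _ P] exI[of _ "\<lambda>_. N"]) (auto simp: N_def S_def)
  qed
  have part2: "is_direct_sum R M I (\<lambda>i. component R M (Q i))"
    if Q: "bij_betw Q I ?Min" for I :: "'i set" and Q
  proof -
    have Qin: "Q i \<in> ?Min" if "i \<in> I" for i
      using bij_betwE[OF Q] that by blast
    have "finite I"
      using Q finMin bij_betw_finite by blast
    moreover have "comaximal R (ideal_pow R (Q i) m) (ideal_pow R (Q j) n)"
      if "i \<in> I" "j \<in> I" "i \<noteq> j" for i j m n
    proof -
      have "Q i \<noteq> Q j"
        using that Q by (auto simp: bij_betw_def dest: inj_onD)
      then show ?thesis
        using that Qin by (intro comaximal_pow id comax)
    qed
    moreover have "ideal_meet R I (\<lambda>i. ideal_pow R (Q i) N)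
        = ideal_meet R ?Min (\<lambda>P. ideal_pow R P N)"
      using ideal_meet_image[of R Q I] unfolding bij_betw_imp_surj_on[OF Q] by simp
    \<comment> \<open>Here the chains are the powers of each \<open>Q i\<close>, and level
      \<open>N\<close> is one where their meet kills \<open>M\<close>.\<close>
    ultimately have "is_direct_sum R M I (\<lambda>i. \<Union>k. l_ann M (ideal_pow R (Q i) k))"
      using kill by (intro direct_sum_of_comaximal_chains[where k = N])
        (simp_all add: ideal_pow_ideal ideal_pow_antimono id Qin del: mem_Collect_eq)
    moreover have "component R M (Q i) = (\<Union>k. l_ann M (ideal_pow R (Q i) k))" if "i \<in> I" for i
      by (intro component_eq_UN id Qin that)
    ultimately show ?thesis
      by (subst is_direct_sum_cong)
  qed
  show ?thesis
    using part1 part2 by blast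
qed

end
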